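(* Let $a:[0,1]\to[0,\infty)$ be continuous and suppose there is a point $x_0\in(0,1)$ such that $a(x_0)=0$, $a>0$ on $[0,1]\setminus\{x_0\}$ and $\frac1a\notin L^1(0,1)$. Assume also that there exist $K\in[1,2]$ and $C>0$ such that $\frac{1}{a(x)}\le\frac{C}{|x-x_0|^K}$ for all $x\in[0,1]\setminus\{x_0\}$. Let $$X:=\left\{u\in H^2_{\frac1a}(0,1):\ u(x_0)=(au')(x_0)=0\right\}.$$ Then $X=H^2_{\frac1a}(0,1)$, and on this space $\|u\|_2^2$ and $\int_0^1(u'')^2(x)\,dx$ are equivalent (squared) norms.
   Context: Functions are real valued. $L^2_{\frac1a}(0,1):=\{u\in L^2(0,1): \int_0^1 \frac{u^2}{a}\,dx<+\infty\}$ with norm $\|u\|^2_{L^2_{1/a}(0,1)}=\int_0^1\frac{u^2}{a}\,dx$. $H^2_0(0,1):=\{u\in H^2(0,1): u(j)=u'(j)=0,\ j=0,1\}$, $H^2_{\frac1a}(0,1):=L^2_{\frac1a}(0,1)\cap H^2_0(0,1)$, and $\|u\|_2^2:=\|u\|^2_{L^2_{1/a}(0,1)}+\|u''\|^2_{L^2(0,1)}$. *)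

theory Defs
  imports "HOL-Analysis.Analysis"
begin

text \<open>
  Elements of the function spaces over the open interval $(0,1)$ are total functions on the reals,
  of which only the values in $(0,1)$ matter; two functions that agree almost everywhere on
  $(0,1)$ represent the same element.  Pointwise values, including those at the end points, are
  those of the continuous representative on $[0,1]$.
\<close>

abbreviation unit_leb :: "real measure" where
  "unit_leb \<equiv> lebesgue_on {0<..<1}"

definition L2 :: "(real \<Rightarrow> real) set" where
  "L2 = {u \<in> borel_measurable unit_leb. integrable unit_leb (\<lambda>x. (u x)\<^sup>2)}"

definition test_functions :: "(real \<Rightarrow> real) set" where
  "test_functions = {\<phi>. \<phi> C1_differentiable_on UNIV \<and> closure {x. \<phi> x \<noteq> 0} \<subseteq> {0<..<1}}"

text \<open>
  Weak derivatives are tested against $C^1_c(0,1)$, which is a common convention in one dimension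
  and gives the same notion as testing against $C^\infty_c(0,1)$.
\<close>

definition has_weak_deriv :: "(real \<Rightarrow> real) \<Rightarrow> (real \<Rightarrow> real) \<Rightarrow> bool" where
  "has_weak_deriv u v \<longleftrightarrow>
     (\<forall>\<phi>\<in>test_functions. (LINT x|unit_leb. u x * deriv \<phi> x) = - (LINT x|unit_leb. v x * \<phi> x))"

definition H1 :: "(real \<Rightarrow> real) set" where
  "H1 = {u \<in> L2. \<exists>v\<in>L2. has_weak_deriv u v}"

text \<open>For functions in \<^term>\<open>H1\<close> the weak derivative is determined up to null sets.\<close>

definition wderiv :: "(real \<Rightarrow> real) \<Rightarrow> real \<Rightarrow> real" where
  "wderiv u = (SOME v. v \<in> L2 \<and> has_weak_deriv u v)"

definition H2 :: "(real \<Rightarrow> real) set" where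
  "H2 = {u \<in> H1. wderiv u \<in> H1}"

text \<open>
  The continuous representative; if it exists, its values on $[0,1]$ are unique, while its values
  outside $[0,1]$ are irrelevant.
\<close>

definition cont_rep :: "(real \<Rightarrow> real) \<Rightarrow> real \<Rightarrow> real" where
  "cont_rep u = (SOME w. continuous_on {0..1} w \<and> (AE x in unit_leb. u x = w x))"

definition H20 :: "(real \<Rightarrow> real) set" where
  "H20 = {u \<in> H2. \<forall>j\<in>{0, 1}. cont_rep u j = 0 \<and> cont_rep (wderiv u) j = 0}"

text \<open>
  The weight \<open>a\<close> vanishes at most at one point below, so the convention \<open>y / 0 = 0\<close> affects the
  integrands on a null set only.
\<close>

definition L2_inv :: "(real \<Rightarrow> real) \<Rightarrow> (real \<Rightarrow> real) set" where
  "L2_inv a = {u \<in> L2. integrable unit_leb (\<lambda>x. (u x)\<^sup>2 / a x)}"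

definition H2_inv :: "(real \<Rightarrow> real) \<Rightarrow> (real \<Rightarrow> real) set" where
  "H2_inv a = L2_inv a \<inter> H20"

definition sqnorm_dd :: "(real \<Rightarrow> real) \<Rightarrow> real" where
  "sqnorm_dd u = (LINT x|unit_leb. (wderiv (wderiv u) x)\<^sup>2)"

definition sqnorm2 :: "(real \<Rightarrow> real) \<Rightarrow> (real \<Rightarrow> real) \<Rightarrow> real" where
  "sqnorm2 a u = (LINT x|unit_leb. (u x)\<^sup>2 / a x) + sqnorm_dd u"

definition X_space :: "(real \<Rightarrow> real) \<Rightarrow> real \<Rightarrow> (real \<Rightarrow> real) set" where
  "X_space a x0 =
     {u \<in> H2_inv a. cont_rep u x0 = 0 \<and> cont_rep (\<lambda>x. a x * wderiv u x) x0 = 0}"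

text \<open>
  A norm on a vector space of functions modulo equality almost everywhere on $(0,1)$.  That the
  norm depends only on the equivalence class follows from definiteness and the triangle inequality.
\<close>

definition ae_norm_on :: "(real \<Rightarrow> real) set \<Rightarrow> ((real \<Rightarrow> real) \<Rightarrow> real) \<Rightarrow> bool" where
  "ae_norm_on V N \<longleftrightarrow>
     (\<lambda>x. 0) \<in> V \<and>
     (\<forall>u\<in>V. \<forall>v\<in>V. (\<lambda>x. u x + v x) \<in> V \<and> N (\<lambda>x. u x + v x) \<le> N u + N v) \<and>
     (\<forall>u\<in>V. \<forall>c. (\<lambda>x. c * u x) \<in> V \<and> N (\<lambda>x. c * u x) = \<bar>c\<bar> * N u) \<and>
     (\<forall>u\<in>V. 0 \<le> N u \<and> (N u = 0 \<longleftrightarrow> (AE x in unit_leb. u x = 0)))"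

definition equivalent_norms_on ::
  "(real \<Rightarrow> real) set \<Rightarrow> ((real \<Rightarrow> real) \<Rightarrow> real) \<Rightarrow> ((real \<Rightarrow> real) \<Rightarrow> real) \<Rightarrow> bool" where
  "equivalent_norms_on V M N \<longleftrightarrow>
     ae_norm_on V M \<and> ae_norm_on V N \<and>
     (\<exists>c>0. \<exists>d>0. \<forall>u\<in>V. c * N u \<le> M u \<and> M u \<le> d * N u)"

end

(* An element u of H20 has a C1 representative, still called u, with |u'| <= (int u''^2)^(1/2),
   since u'(0) = 0.  If u(x0) were nonzero, then u^2 + a would be bounded below by a positive
   constant, and integrability of u^2/a would force that of 1/a.  Hence u(x0) = 0 and
   |u(x)| <= |x - x0| (int u''^2)^(1/2).  As K <= 2, dividing by a gives the pointwise bound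
   u^2/a <= C int u''^2, so that no Hardy inequality is needed.  The continuous representatives
   come from the du Bois-Reymond lemma: u has weak derivative v iff u is a primitive of v. *)
theory Submission
  imports Defs
begin

section \<open>Primitives on the unit interval and test functions\<close>

text \<open>\<open>wderiv\<close> and \<open>cont_rep\<close> are Hilbert choices, so they cannot be
  computed from their definitions. Statements about \<open>H20\<close> are therefore moved to the
  relation \<open>H20_with_dd u w\<close>, in which \<open>u\<close> is a double primitive of
  \<open>w\<close>. This relation is visibly linear, and it fixes \<open>wderiv u\<close> and
  \<open>wderiv (wderiv u)\<close> up to null sets and \<open>cont_rep u\<close> on the closed
  interval. The condition on \<open>a u'\<close> at \<open>x0\<close> holds for every
  \<open>u\<close> in \<open>H20\<close>, since \<open>u'\<close> has a continuous representative
  and \<open>a x0 = 0\<close>. Equivalence of norms includes that both expressions are norms.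
  Definiteness of the second-derivative norm comes from the clamping: if \<open>w\<close> vanishes
  a.e., so does its double primitive. The other norm inherits definiteness from the two-sided
  estimate, whose constants are 1, because \<open>sqnorm_dd\<close> is a summand of
  \<open>sqnorm2\<close>, and \<open>sqrt (1 + C)\<close>, because the other summand is at most
  \<open>C\<close> times \<open>sqnorm_dd\<close>.\<close>

lemma unit_leb_simps [simp]:
  "space unit_leb = {0<..<1}" "measure unit_leb {0<..<1} = 1"
  "emeasure unit_leb {0<..<1} = 1"
  by (simp_all add: measure_restrict_space emeasure_restrict_space)

interpretation UL: finite_measure unit_leb
  by (rule finite_measureI) simp

lemma borel_unit_leb [measurable (raw)]:
  "f \<in> borel_measurable borel \<Longrightarrow> f \<in> borel_measurable unit_leb"
  by (rule measurable_restrict_space1) (simp add: measurable_completion)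

lemma ident_unit_leb [measurable]: "(\<lambda>x. x) \<in> measurable unit_leb borel"
  by (rule borel_unit_leb) simp

text \<open>The integral of \<open>v\<close> from 0 to \<open>x\<close>. The cut-off by a half-line
  keeps the measure fixed as \<open>x\<close> varies, makes the function total (constant to the left
  of 0 and to the right of 1), and produces sets that generate the Borel sets.\<close>

definition prim :: "(real \<Rightarrow> real) \<Rightarrow> real \<Rightarrow> real" where
  "prim v x = (LINT t|unit_leb. indicator {..<x} t * v t)"

lemma integrable_indicator_mult:
  fixes v :: "real \<Rightarrow> real"
  assumes "integrable unit_leb v" "A \<in> sets borel"
  shows "integrable unit_leb (\<lambda>t. indicator A t * v t)"
proof (rule Bochner_Integration.integrable_bound)
  show "integrable unit_leb v" by fact
  have [measurable]: "v \<in> borel_measurable unit_leb" using assms by auto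
  have [measurable]: "(indicator A::real\<Rightarrow>real) \<in> borel_measurable unit_leb"
    using assms by (intro borel_unit_leb) simp
  show "(\<lambda>t. indicator A t * v t) \<in> borel_measurable unit_leb" by measurable
qed (auto simp: indicator_def)

text \<open>The half-lines are stable under intersection and generate the Borel sets, so a Dynkin
  induction carries the vanishing of the integral of \<open>f\<close> from half-lines to all Borel
  sets. Null sets then give all Lebesgue sets.\<close>

lemma AE_zero_if_prim_zero:
  assumes f: "integrable unit_leb f" and z: "\<And>x. x \<in> {0..1} \<Longrightarrow> prim f x = 0"
  shows "AE x in unit_leb. f x = 0"
proof -
  have z: "prim f x = 0" for x
  proof -
    have "prim f x = prim f (max 0 (min 1 x))"
      unfolding prim_def by (intro Bochner_Integration.integral_cong) (auto simp: indicator_def)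
    then show ?thesis using z by simp
  qed
  have B: "(LINT t|unit_leb. indicator A t * f t) = 0" if "A \<in> sets borel" for A
  proof -
    have "Int_stable (range lessThan :: real set set)" "range lessThan \<subseteq> Pow (UNIV :: real set)"
      "A \<in> sigma_sets UNIV (range lessThan)"
      using that by (auto simp: Int_stable_def borel_Iio greaterThan_Int_greaterThan)
    then show ?thesis
    proof (induction rule: sigma_sets_induct_disjoint)
      case (basic A)
      then show ?case using z by (auto simp: prim_def)
    next
      case empty
      then show ?case by simp
    next
      case (compl A)
      then have A: "A \<in> sets borel" by (simp add: borel_Iio)
      \<comment> \<open>At 1 the cut-off is invisible on the open unit interval, so the total
        integral vanishes too; complements need this.\<close>
      have "(LINT t|unit_leb. f t) = prim f 1"
        unfolding prim_def by (rule Bochner_Integration.integral_cong) auto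
      then have "(LINT t|unit_leb. f t - indicator A t * f t) = 0"
        using compl f integrable_indicator_mult[OF f A] z
        by (subst Bochner_Integration.integral_diff) auto
      also have "(\<lambda>t. f t - indicator A t * f t) = (\<lambda>t. indicator (UNIV - A) t * f t)"
        by (auto simp: indicator_def)
      finally show ?case .
    next
      case (union A)
      then have A: "A i \<in> sets borel" for i by (auto simp: borel_Iio)
      have fm: "f \<in> borel_measurable unit_leb" using f by auto
      have "(\<lambda>n. LINT t|unit_leb. indicator (\<Union>i<n. A i) t * f t) \<longlonglongrightarrow>
            (LINT t|unit_leb. indicator (\<Union>i. A i) t * f t)"
      proof (rule integral_dominated_convergence[where w = "\<lambda>t. \<bar>f t\<bar>"])
        show "(\<lambda>t. indicator (\<Union>i. A i) t * f t) \<in> borel_measurable unit_leb"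
          using integrable_indicator_mult[OF f] A by blast
        show "(\<lambda>t. indicator (\<Union>i<n. A i) t * f t) \<in> borel_measurable unit_leb" for n
          using integrable_indicator_mult[OF f, of "\<Union>i<n. A i"] A by blast
        show "AE t in unit_leb. (\<lambda>n. indicator (\<Union>i<n. A i) t * f t) \<longlonglongrightarrow> indicator (\<Union>i. A i) t * f t"
          by (intro AE_I2 tendsto_mult LIMSEQ_indicator_UN tendsto_const)
      qed (use f in \<open>auto simp: indicator_def\<close>)
      moreover have "(LINT t|unit_leb. indicator (\<Union>i<n. A i) t * f t) = 0" for n
      proof (induction n)
        case (Suc n)
        have dj: "t \<notin> A i" if "t \<in> A n" "i < n" for t i
          using disjoint_family_onD[OF union(1), of i n] that by auto
        have "(\<lambda>t. indicator (\<Union>i<Suc n. A i) t * f t)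
            = (\<lambda>t. indicator (\<Union>i<n. A i) t * f t + indicator (A n) t * f t)"
          by (intro ext) (auto simp: indicator_def lessThan_Suc dj)
        then show ?case
          using Suc union(3)[of n] integrable_indicator_mult[OF f, of "\<Union>i<n. A i"]
            integrable_indicator_mult[OF f, of "A n"] A
          by simp
      qed simp
      ultimately show ?case using LIMSEQ_unique[of "\<lambda>_. 0::real" 0] by auto
    qed
  qed
  show ?thesis
  proof (rule UL.density_zero[OF f])
    \<comment> \<open>The density argument asks for Lebesgue sets, while \<open>B\<close> covers
      Borel sets: \<open>A\<close> is a Borel set \<open>S\<close> up to a part of a Borel null set
      \<open>N'\<close>.\<close>
    fix A assume "A \<in> sets unit_leb"
    then have "A \<in> sets lebesgue" "A \<subseteq> {0<..<1}"
      by (auto simp: sets_restrict_space)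
    then obtain S N N' where S: "A = S \<union> N" "N \<subseteq> N'" "N' \<in> null_sets lborel" "S \<in> sets lborel"
      by (elim sets_completionE) auto
    have "AE x in lebesgue. x \<notin> N'" using S AE_completion AE_not_in by blast
    then have ae: "AE x in unit_leb. x \<notin> N'"
      by (subst AE_restrict_space_iff) auto
    have "(LINT t|unit_leb. indicator A t * f t) = (LINT t|unit_leb. indicator S t * f t)"
    proof (rule integral_cong_AE)
      have [measurable]: "A \<in> sets unit_leb" "f \<in> borel_measurable unit_leb" by fact (use f in auto)
      show "(\<lambda>t. indicator A t * f t) \<in> borel_measurable unit_leb" by measurable
      show "(\<lambda>t. indicator S t * f t) \<in> borel_measurable unit_leb"
        using integrable_indicator_mult[OF f] S by auto
      show "AE t in unit_leb. indicator A t * f t = indicator S t * f t"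
        using ae by eventually_elim (use S in \<open>auto simp: indicator_def\<close>)
    qed
    then show "set_lebesgue_integral unit_leb A f = 0"
      using B[of S] S by (simp add: set_lebesgue_integral_def)
  qed
qed

section \<open>Test functions and their derivatives\<close>

lemma test_function_deriv:
  assumes "\<phi> \<in> test_functions"
  shows "continuous_on UNIV (deriv \<phi>)" "\<And>x. (\<phi> has_real_derivative deriv \<phi> x) (at x)"
    "\<And>x. x \<notin> {0<..<1} \<Longrightarrow> \<phi> x = 0"
proof -
  obtain D where D: "\<And>x. (\<phi> has_real_derivative D x) (at x)" "continuous_on UNIV D"
    using assms unfolding test_functions_def C1_differentiable_on_def
    by (auto simp: has_real_derivative_iff_has_vector_derivative)
  then have "deriv \<phi> = D" by (auto intro!: ext DERIV_imp_deriv)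
  then show "continuous_on UNIV (deriv \<phi>)" "\<And>x. (\<phi> has_real_derivative deriv \<phi> x) (at x)"
    using D by auto
  fix x::real assume "x \<notin> {0<..<1}"
  then show "\<phi> x = 0"
    using assms closure_subset[of "{x. \<phi> x \<noteq> 0}"] unfolding test_functions_def by blast
qed

text \<open>A bridge to the gauge integral over the closed interval, for which the fundamental
  theorem of calculus is stated.\<close>

lemma continuous_unit_leb:
  fixes h :: "real \<Rightarrow> real"
  assumes "continuous_on {0..1} h"
  shows "integrable unit_leb h" "(LINT x|unit_leb. h x) = integral {0..1} h"
proof -
  have "h absolutely_integrable_on {0..1}"
    using assms by (rule absolutely_integrable_continuous_real)
  then have "h absolutely_integrable_on {0<..<1}"
    by (rule set_integrable_subset) auto
  then show i: "integrable unit_leb h"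
    by (simp add: set_integrable_def integrable_restrict_space)
  show "(LINT x|unit_leb. h x) = integral {0..1} h"
    using lebesgue_integral_eq_integral[OF i] integral_open_interval_real[of 0 1 h] by simp
qed

text \<open>The antiderivative with value 0 at 0 stays 0 up to \<open>\<alpha>\<close>, because
  \<open>h\<close> vanishes there. The vanishing total integral brings it back to 0 at 1, and hence
  it is 0 everywhere beyond \<open>\<beta>\<close>.\<close>

lemma test_function_antiderivative:
  assumes h: "continuous_on UNIV h" and ab: "0 < \<alpha>" "\<beta> < 1"
    and h0: "\<And>x. x \<notin> {\<alpha>..\<beta>} \<Longrightarrow> h x = 0" and int0: "(LINT x|unit_leb. h x) = 0"
  obtains \<phi> where "\<phi> \<in> test_functions" "deriv \<phi> = h"
proof -
  have hI: "continuous_on S h" for S using h continuous_on_subset by blast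
  obtain F where F: "\<And>x. (F has_vector_derivative h x) (at x)"
    using einterval_antiderivative[of "-\<infinity>" "\<infinity>" h] h
    by (auto simp: continuous_on_eq_continuous_at)
  define \<phi> where "\<phi> x = F x - F 0" for x
  have d: "(\<phi> has_vector_derivative h x) (at x)" for x
    unfolding \<phi>_def using F[of x] by (auto intro!: derivative_eq_intros)
  have FTC: "(h has_integral \<phi> y - \<phi> x) {x..y}" if "x \<le> y" for x y
    using that d by (intro fundamental_theorem_of_calculus) (auto intro: has_vector_derivative_at_within)
  have const: "\<phi> y = \<phi> x" if "x \<le> y" "\<And>z. z \<in> {x..y} \<Longrightarrow> h z = 0" for x y
  proof -
    have "(h has_integral 0) {x..y}" using that(2) by (rule has_integral_is_0)
    from has_integral_unique[OF FTC[OF that(1)] this] show ?thesis by simp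
  qed
  have z: "\<phi> 0 = 0" by (simp add: \<phi>_def)
  have "\<phi> 1 = 0"
    using FTC[of 0 1] int0 z continuous_unit_leb(2)[OF hI, symmetric] by (simp add: integral_unique)
  have "\<phi> x = 0" if "x \<notin> {\<alpha>..\<beta>}" for x
  proof (cases "x < \<alpha>")
    case True
    show ?thesis
      using const[of x 0] const[of 0 x] h0 True ab z by (cases "x \<le> 0") auto
  next
    case False
    then show ?thesis
      using const[of x 1] const[of 1 x] h0 that ab \<open>\<phi> 1 = 0\<close> by (cases "x \<le> 1") auto
  qed
  then have "{x. \<phi> x \<noteq> 0} \<subseteq> {\<alpha>..\<beta>}" by blast
  then have "closure {x. \<phi> x \<noteq> 0} \<subseteq> {\<alpha>..\<beta>}" by (intro closure_minimal) auto
  then have "\<phi> \<in> test_functions"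
    using d h ab unfolding test_functions_def C1_differentiable_on_def by (force intro: exI[of _ h])
  moreover have "deriv \<phi> = h"
    using d by (auto intro!: ext DERIV_imp_deriv simp: has_real_derivative_iff_has_vector_derivative)
  ultimately show ?thesis using that by blast
qed

section \<open>Weak derivatives\<close>

lemma continuous_on_unit_bound:
  fixes h :: "real \<Rightarrow> real"
  assumes "continuous_on {0..1} h"
  shows "\<exists>B. \<forall>x\<in>{0..1}. \<bar>h x\<bar> \<le> B"
proof -
  have "bounded (h ` {0..1})"
    using assms by (intro compact_imp_bounded compact_continuous_image) auto
  then show ?thesis by (simp add: bounded_iff)
qed

lemma integrable_mult_continuous:
  fixes v h :: "real \<Rightarrow> real"
  assumes v: "integrable unit_leb v" and h: "continuous_on {0..1} h"
  shows "integrable unit_leb (\<lambda>x. v x * h x)"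
proof -
  obtain B where B: "\<forall>x\<in>{0..1}. \<bar>h x\<bar> \<le> B"
    using continuous_on_unit_bound[OF h] by blast
  have [measurable]: "v \<in> borel_measurable unit_leb" "h \<in> borel_measurable unit_leb"
    using v continuous_unit_leb(1)[OF h] by auto
  show ?thesis
  proof (rule Bochner_Integration.integrable_bound)
    show "integrable unit_leb (\<lambda>x. B * v x)" using v by simp
    show "AE x in unit_leb. norm (v x * h x) \<le> norm (B * v x)"
    proof (rule AE_I2)
      fix x assume "x \<in> space unit_leb"
      then have "\<bar>h x\<bar> \<le> B" using B by auto
      then have "\<bar>h x\<bar> \<le> \<bar>B\<bar>" by linarith
      from mult_left_mono[OF this, of "\<bar>v x\<bar>"] show "norm (v x * h x) \<le> norm (B * v x)"
        by (simp add: abs_mult mult.commute)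
    qed
  qed measurable
qed

text \<open>The positive part of a parabola, divided by its mass. A continuous bump serves here
  because test functions are C1, so that their derivatives are merely continuous.\<close>

lemma bump_exists:
  obtains \<psi> :: "real \<Rightarrow> real" where "continuous_on UNIV \<psi>" "(LINT x|unit_leb. \<psi> x) = 1"
    "\<And>x. x \<notin> {1/4..3/4} \<Longrightarrow> \<psi> x = 0"
proof -
  define \<psi> :: "real \<Rightarrow> real" where "\<psi> x = max 0 ((x - 1/4) * (3/4 - x))" for x
  have c: "continuous_on S \<psi>" for S unfolding \<psi>_def by (intro continuous_intros)
  have z: "\<psi> x = 0" if "x \<notin> {1/4..3/4}" for x
  proof -
    have "x < 1/4 \<or> 3/4 < x" using that by auto
    then have "(x - 1/4) * (3/4 - x) \<le> 0"
      by (auto intro: mult_nonpos_nonneg mult_nonneg_nonpos)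
    then show ?thesis by (simp add: \<psi>_def)
  qed
  have "integral {0..1} \<psi> \<noteq> 0"
  proof
    assume "integral {0..1} \<psi> = 0"
    then have "(\<psi> has_integral 0) (cbox 0 1)"
      using integrable_integral[OF integrable_continuous_real[OF c, of 0 1]] by simp
    then have "\<psi> (1/2) = 0"
      by (rule has_integral_0_cbox_imp_0[OF c, rotated 1]) (auto simp: \<psi>_def)
    then show False by (simp add: \<psi>_def max_def)
  qed
  then have J: "(LINT x|unit_leb. \<psi> x) \<noteq> 0" using continuous_unit_leb(2)[OF c] by simp
  show ?thesis
    by (rule that[of "\<lambda>x. \<psi> x / (LINT x|unit_leb. \<psi> x)"])
      (use J z in \<open>auto intro!: continuous_intros c\<close>)
qed

text \<open>After subtraction of the right constant, \<open>g\<close> is orthogonal to every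
  continuous function supported in a compact part of the open interval, not only to derivatives.
  Such functions approximate the indicators of half-lines, so the primitive of the difference
  vanishes.\<close>

lemma du_Bois_Reymond:
  assumes g: "integrable unit_leb g"
    and orth: "\<And>\<phi>. \<phi> \<in> test_functions \<Longrightarrow> (LINT x|unit_leb. g x * deriv \<phi> x) = 0"
  shows "\<exists>c. AE x in unit_leb. g x = c"
proof -
  obtain \<psi> :: "real \<Rightarrow> real" where \<psi>: "continuous_on UNIV \<psi>" "(LINT x|unit_leb. \<psi> x) = 1"
    "\<And>x. x \<notin> {1/4..3/4} \<Longrightarrow> \<psi> x = 0"
    by (rule bump_exists) blast
  \<comment> \<open>Since \<open>\<psi>\<close> has mass one, this is the only value that an a.e.
    constant \<open>g\<close> can have.\<close>
  define c where "c = (LINT x|unit_leb. g x * \<psi> x)"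
  define f where "f x = g x - c" for x
  have f: "integrable unit_leb f" unfolding f_def using g by simp
  text \<open>
    The multiple of \<open>\<psi>\<close> subtracted from \<open>h\<close> makes the integral vanish, so that the difference is
    the derivative of a test function.
  \<close>
  have fh: "(LINT x|unit_leb. f x * h x) = 0"
    if h: "continuous_on UNIV h" "0 < \<alpha>" "\<beta> < 1" "\<And>x. x \<notin> {\<alpha>..\<beta>} \<Longrightarrow> h x = 0" for h \<alpha> \<beta>
  proof -
    define k where "k = (LINT x|unit_leb. h x)"
    have S: "continuous_on S h" "continuous_on S \<psi>" for S
      by (auto intro: continuous_on_subset[OF h(1)] continuous_on_subset[OF \<psi>(1)])
    note int = continuous_unit_leb(1)[OF S(1)] continuous_unit_leb(1)[OF S(2)]
      integrable_mult_continuous[OF g S(1)] integrable_mult_continuous[OF g S(2)]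
    obtain \<phi> where \<phi>: "\<phi> \<in> test_functions" "deriv \<phi> = (\<lambda>x. h x - k * \<psi> x)"
    proof (rule test_function_antiderivative[of "\<lambda>x. h x - k * \<psi> x" "min \<alpha> (1/4)" "max \<beta> (3/4)"])
      show "h x - k * \<psi> x = 0" if "x \<notin> {min \<alpha> (1/4)..max \<beta> (3/4)}" for x
        using that h(4)[of x] \<psi>(3)[of x] by (auto simp: min_le_iff_disj le_max_iff_disj)
      show "(LINT x|unit_leb. h x - k * \<psi> x) = 0"
        using int \<psi>(2) by (simp add: k_def)
    qed (use h(2,3) in \<open>auto intro!: continuous_intros S\<close>)
    have "0 = (LINT x|unit_leb. g x * h x - k * (g x * \<psi> x))"
      using orth[OF \<phi>(1)] \<phi>(2) by (simp add: algebra_simps)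
    also have "\<dots> = (LINT x|unit_leb. g x * h x) - k * c"
      using int by (simp add: c_def)
    also have "\<dots> = (LINT x|unit_leb. g x * h x - c * h x)"
      using int by (simp add: k_def)
    finally show ?thesis by (simp add: f_def algebra_simps)
  qed
  have "AE x in unit_leb. f x = 0"
  proof (rule AE_zero_if_prim_zero[OF f])
    fix x :: real assume x: "x \<in> {0..1}"
    \<comment> \<open>A trapezoid: 0 where the distance to the complement of \<open>(0, x)\<close>
      is at most \<open>1 / Suc n\<close>, and 1 where it is at least \<open>2 / Suc n\<close>. Its
      support is thus compact in the open interval, and its limit on positive arguments is the
      indicator of \<open>{..<x}\<close>.\<close>
    define h where "h n y = max 0 (min 1 (real (Suc n) * min y (x - y) - 1))" for n y
    have hc: "continuous_on UNIV (h n)" for n unfolding h_def by (intro continuous_intros)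
    have "(\<lambda>n. LINT t|unit_leb. f t * h n t) \<longlonglongrightarrow> (LINT t|unit_leb. indicator {..<x} t * f t)"
    proof (rule integral_dominated_convergence[where w = "\<lambda>t. \<bar>f t\<bar>"])
      show "(\<lambda>t. indicator {..<x} t * f t) \<in> borel_measurable unit_leb"
        by (intro borel_measurable_integrable integrable_indicator_mult f) simp
      show "(\<lambda>t. f t * h n t) \<in> borel_measurable unit_leb" for n
        by (intro borel_measurable_integrable integrable_mult_continuous f continuous_on_subset[OF hc]) simp
      show "AE t in unit_leb. (\<lambda>n. f t * h n t) \<longlonglongrightarrow> indicator {..<x} t * f t"
      proof (rule AE_I2)
        fix t assume "t \<in> space unit_leb"
        then have t: "0 < t" by simp
        have "(\<lambda>n. h n t) \<longlonglongrightarrow> indicator {..<x} t"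
        proof (cases "t < x")
          case True
          define m where "m = min t (x - t)"
          have m: "m > 0" using True t by (simp add: m_def)
          obtain N :: nat where N: "2 / m < real N" using reals_Archimedean2 by blast
          have "\<forall>\<^sub>F n in sequentially. h n t = 1"
          proof (rule eventually_sequentiallyI)
            fix n assume "N \<le> n"
            then have "2 / m < real (Suc n)" using N by simp
            then have "2 < real (Suc n) * m" using m by (simp add: field_simps)
            then show "h n t = 1" unfolding h_def m_def[symmetric] by simp
          qed
          then show ?thesis using True by (simp add: tendsto_eventually)
        next
          case False
          then have "real (Suc n) * min t (x - t) \<le> 0" for n
            by (intro mult_nonneg_nonpos) auto
          moreover have "max 0 (min 1 (z - 1)) = 0" if "z \<le> 0" for z :: real using that by simp
          ultimately have "h n t = 0" for n unfolding h_def by blast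
          then show ?thesis using False by simp
        qed
        from tendsto_mult_left[OF this, of "f t"]
        show "(\<lambda>n. f t * h n t) \<longlonglongrightarrow> indicator {..<x} t * f t" by (simp add: mult.commute)
      qed
      show "AE t in unit_leb. norm (f t * h n t) \<le> \<bar>f t\<bar>" for n
        proof (rule AE_I2)
        fix t
        have "\<bar>h n t\<bar> \<le> 1" by (simp add: h_def)
        then show "norm (f t * h n t) \<le> \<bar>f t\<bar>" by (simp add: abs_mult mult_left_le)
      qed
    qed (use f in auto)
    moreover have "(LINT t|unit_leb. f t * h n t) = 0" for n
    proof (rule fh[OF hc, of "1 / real (Suc n)" "x - 1 / real (Suc n)"])
      show "x - 1 / real (Suc n) < 1"
      proof -
        have "0 < 1 / real (Suc n)" by simp
        then show ?thesis using x unfolding atLeastAtMost_iff by linarith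
      qed
      show "h n y = 0" if "y \<notin> {1 / real (Suc n)..x - 1 / real (Suc n)}" for y
      proof -
        have "min y (x - y) \<le> 1 / real (Suc n)" using that by auto
        then have "real (Suc n) * min y (x - y) \<le> real (Suc n) * (1 / real (Suc n))"
          by (intro mult_left_mono) auto
        then show ?thesis by (simp add: h_def)
      qed
    qed simp
    ultimately show "prim f x = 0"
      unfolding prim_def by (simp add: LIMSEQ_const_iff)
  qed
  then have "AE x in unit_leb. g x = c" by eventually_elim (simp add: f_def)
  then show ?thesis by blast
qed

section \<open>Primitives as functions with a weak derivative\<close>

text \<open>The cut-offs at \<open>X n\<close> converge to the cut-off at \<open>x\<close> except
  possibly at the single point \<open>x\<close>, and \<open>\<bar>v\<bar>\<close> dominates.\<close>

lemma continuous_prim: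
  assumes v: "integrable unit_leb v"
  shows "continuous_on S (prim v)"
proof -
  have "isCont (prim v) x" for x
    unfolding continuous_at_sequentially
  proof safe
    fix X assume X: "X \<longlonglongrightarrow> x"
    have m: "(\<lambda>t. indicator {..<y} t * v t) \<in> borel_measurable unit_leb" for y
      using integrable_indicator_mult[OF v, of "{..<y}"] by auto
    have "AE t in lebesgue. t \<noteq> x" using AE_completion[OF AE_lborel_singleton] .
    then have ae: "AE t in unit_leb. t \<noteq> x" by (subst AE_restrict_space_iff) auto
    show "(prim v \<circ> X) \<longlonglongrightarrow> prim v x"
      unfolding prim_def o_def
    proof (rule integral_dominated_convergence[where w = "\<lambda>t. \<bar>v t\<bar>"])
      show "AE t in unit_leb. (\<lambda>n. indicator {..<X n} t * v t) \<longlonglongrightarrow> indicator {..<x} t * v t"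
        using ae
      proof eventually_elim
        fix t assume "t \<noteq> x"
        then have "\<forall>\<^sub>F n in sequentially. indicator {..<X n} t = (indicator {..<x} t :: real)"
        proof (cases "t < x")
          case True
          from order_tendstoD(1)[OF X True] show ?thesis
            by eventually_elim (use True in auto)
        next
          case False
          then have "x < t" using \<open>t \<noteq> x\<close> by simp
          from order_tendstoD(2)[OF X this] show ?thesis
            by eventually_elim (use False in auto)
        qed
        then show "(\<lambda>n. indicator {..<X n} t * v t) \<longlonglongrightarrow> indicator {..<x} t * v t"
          by (intro tendsto_eventually) (auto elim: eventually_mono)
      qed
    qed (use v m in \<open>auto simp: indicator_def\<close>)
  qed
  then show ?thesis by (auto intro: continuous_at_imp_continuous_on)
qed

text \<open>The inner integral that remains after Fubini in \<open>has_weak_deriv_prim\<close>. The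
  boundary term at 1 vanishes, and for \<open>x\<close> at least 1 both sides are 0.\<close>

lemma test_function_integral_deriv:
  assumes "\<phi> \<in> test_functions" "0 \<le> x"
  shows "(LINT t|unit_leb. indicator {x<..} t * deriv \<phi> t) = - \<phi> x"
proof (cases "x < 1")
  case True
  note \<phi> = test_function_deriv[OF assms(1)]
  have c: "continuous_on S (deriv \<phi>)" for S using \<phi>(1) continuous_on_subset by blast
  have i: "integrable unit_leb (\<lambda>t. indicator {x<..} t * deriv \<phi> t)"
    by (intro integrable_indicator_mult continuous_unit_leb c) auto
  have "(LINT t|unit_leb. indicator {x<..} t * deriv \<phi> t)
      = integral {0<..<1} (\<lambda>t. indicator {x<..} t * deriv \<phi> t)"
    by (rule lebesgue_integral_eq_integral[OF i]) simp
  also have "\<dots> = integral {0<..<1} (\<lambda>t. if t \<in> {x<..<1} then deriv \<phi> t else 0)"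
    by (rule integral_cong) (auto simp: indicator_def)
  also have "\<dots> = integral {x<..<1} (deriv \<phi>)"
    using assms by (subst integral_restrict_Int) (auto intro!: arg_cong2[where f = integral])
  also have "\<dots> = integral {x..1} (deriv \<phi>)"
    by (rule integral_open_interval_real[symmetric])
  also have "\<dots> = \<phi> 1 - \<phi> x"
    using True \<phi>(2) by (intro integral_unique fundamental_theorem_of_calculus)
      (auto simp: has_real_derivative_iff_has_vector_derivative intro: has_vector_derivative_at_within)
  finally show ?thesis using \<phi>(3)[of 1] by simp
next
  case False
  then have "(LINT t|unit_leb. indicator {x<..} t * deriv \<phi> t) = (LINT t|unit_leb. 0)"
    by (intro Bochner_Integration.integral_cong) (auto simp: indicator_def)
  then show ?thesis using test_function_deriv(3)[OF assms(1), of x] False by simp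
qed

text \<open>Integration by parts for a merely integrable \<open>v\<close>, by exchanging the order
  of integration over the triangle \<open>t < x\<close>.\<close>

lemma has_weak_deriv_prim:
  assumes v: "integrable unit_leb v"
  shows "has_weak_deriv (prim v) v"
  unfolding has_weak_deriv_def
proof
  fix \<phi> assume \<phi>: "\<phi> \<in> test_functions"
  note d = test_function_deriv[OF \<phi>]
  interpret P: pair_sigma_finite unit_leb unit_leb
    by (intro pair_sigma_finite.intro UL.sigma_finite_measure_axioms)
  have c: "continuous_on S (deriv \<phi>)" for S using d(1) continuous_on_subset by blast
  obtain B where B: "\<forall>x\<in>{0..1}. \<bar>deriv \<phi> x\<bar> \<le> B"
    using continuous_on_unit_bound[OF c] by blast
  have "\<bar>deriv \<phi> 0\<bar> \<le> B" using B by auto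
  then have B0: "0 \<le> B" by linarith
  have [measurable]: "v \<in> borel_measurable unit_leb" using v by auto
  have [measurable]: "deriv \<phi> \<in> borel_measurable unit_leb"
    using continuous_unit_leb(1)[OF c] by auto
  define F where "F t x = indicator {..<x} t * v t * deriv \<phi> x" for t x
  \<comment> \<open>As a comparison of the two coordinates, the cut-off is recognised as jointly
    measurable. Integrability on the product then follows from the bound on
    \<open>deriv \<phi>\<close> and the finiteness of the measure.\<close>
  have F_eq: "case_prod F = (\<lambda>p. (if fst p < snd p then 1 else 0) * v (fst p) * deriv \<phi> (snd p))"
    by (auto simp: F_def indicator_def)
  have Fm: "case_prod F \<in> borel_measurable (unit_leb \<Otimes>\<^sub>M unit_leb)"
    unfolding F_eq by measurable
  have F: "integrable (unit_leb \<Otimes>\<^sub>M unit_leb) (case_prod F)"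
  proof (rule Bochner_Integration.integrable_bound)
    show "integrable (unit_leb \<Otimes>\<^sub>M unit_leb) (\<lambda>p. B * v (fst p))"
    proof (rule P.Fubini_integrable)
      show "integrable unit_leb (\<lambda>x. LINT y|unit_leb. norm (B * v (fst (x, y))))"
        using v by simp
    qed auto
    show "AE p in unit_leb \<Otimes>\<^sub>M unit_leb. norm (case_prod F p) \<le> norm (B * v (fst p))"
    proof (rule AE_I2)
      fix p assume "p \<in> space (unit_leb \<Otimes>\<^sub>M unit_leb)"
      then have "\<bar>deriv \<phi> (snd p)\<bar> \<le> B" using B by (auto simp: space_pair_measure)
      then have "\<bar>v (fst p)\<bar> * \<bar>deriv \<phi> (snd p)\<bar> \<le> \<bar>v (fst p)\<bar> * B" by (rule mult_left_mono) simp
      then show "norm (case_prod F p) \<le> norm (B * v (fst p))"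
        unfolding F_eq using B0 by (auto simp: abs_mult mult.commute)
    qed
  qed fact
  have "(LINT x|unit_leb. prim v x * deriv \<phi> x) = (LINT x|unit_leb. LINT t|unit_leb. F t x)"
    by (simp add: F_def prim_def)
  also have "\<dots> = (LINT t|unit_leb. LINT x|unit_leb. F t x)"
    using P.Fubini_integral[OF F] .
  also have "\<dots> = (LINT t|unit_leb. v t * (LINT x|unit_leb. indicator {t<..} x * deriv \<phi> x))"
  proof (intro Bochner_Integration.integral_cong refl)
    fix t
    have "F t = (\<lambda>x. v t * (indicator {t<..} x * deriv \<phi> x))"
      by (auto simp: F_def indicator_def)
    then show "(LINT x|unit_leb. F t x) = v t * (LINT x|unit_leb. indicator {t<..} x * deriv \<phi> x)"
      by simp
  qed
  also have "\<dots> = (LINT t|unit_leb. - (v t * \<phi> t))"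
    by (intro Bochner_Integration.integral_cong) (auto simp: test_function_integral_deriv[OF \<phi>])
  finally show "(LINT x|unit_leb. prim v x * deriv \<phi> x) = - (LINT x|unit_leb. v x * \<phi> x)"
    by simp
qed

text \<open>By linearity, \<open>u - prim v\<close> has weak derivative zero, so du Bois-Reymond
  makes it constant. Conversely, a constant is annihilated because derivatives of test functions
  have integral zero.\<close>

lemma has_weak_deriv_iff:
  assumes u: "integrable unit_leb u" and v: "integrable unit_leb v"
  shows "has_weak_deriv u v \<longleftrightarrow> (\<exists>c. AE x in unit_leb. u x = c + prim v x)"
proof
  have p: "integrable unit_leb (prim v)"
    using continuous_unit_leb(1)[OF continuous_prim[OF v]] .
  have i: "integrable unit_leb (\<lambda>x. w x * deriv \<phi> x)"
    if "integrable unit_leb w" "\<phi> \<in> test_functions" for w \<phi>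
    using that test_function_deriv(1)[OF that(2)]
    by (intro integrable_mult_continuous) (auto intro: continuous_on_subset)
  {
    assume w: "has_weak_deriv u v"
    have "\<exists>c. AE x in unit_leb. u x - prim v x = c"
    proof (rule du_Bois_Reymond)
      show "integrable unit_leb (\<lambda>x. u x - prim v x)" using u p by simp
      fix \<phi> assume \<phi>: "\<phi> \<in> test_functions"
      have "(LINT x|unit_leb. (u x - prim v x) * deriv \<phi> x)
         = (LINT x|unit_leb. u x * deriv \<phi> x) - (LINT x|unit_leb. prim v x * deriv \<phi> x)"
        using i[OF u \<phi>] i[OF p \<phi>] by (simp add: left_diff_distrib)
      also have "\<dots> = 0"
        using w has_weak_deriv_prim[OF v] \<phi> unfolding has_weak_deriv_def by simp
      finally show "(LINT x|unit_leb. (u x - prim v x) * deriv \<phi> x) = 0" .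
    qed
    then obtain c where "AE x in unit_leb. u x - prim v x = c" by blast
    then have "AE x in unit_leb. u x = c + prim v x" by eventually_elim simp
    then show "\<exists>c. AE x in unit_leb. u x = c + prim v x" by blast
  }
  assume "\<exists>c. AE x in unit_leb. u x = c + prim v x"
  then obtain c where c: "AE x in unit_leb. u x = c + prim v x" by blast
  show "has_weak_deriv u v"
    unfolding has_weak_deriv_def
  proof
    fix \<phi> assume \<phi>: "\<phi> \<in> test_functions"
    \<comment> \<open>The indicator is 1 on the whole interval, so the case of lower limit 0 yields
      the total integral of the derivative.\<close>
    have "(LINT x|unit_leb. indicator {0<..} x * deriv \<phi> x) = (LINT x|unit_leb. deriv \<phi> x)"
      by (intro Bochner_Integration.integral_cong) auto
    then have 0: "(LINT x|unit_leb. deriv \<phi> x) = 0"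
      using test_function_integral_deriv[OF \<phi>, of 0] test_function_deriv(3)[OF \<phi>, of 0] by simp
    have i0: "integrable unit_leb (deriv \<phi>)" using i[of "\<lambda>_. 1", OF _ \<phi>] by simp
    have "(LINT x|unit_leb. u x * deriv \<phi> x)
        = (LINT x|unit_leb. c * deriv \<phi> x + prim v x * deriv \<phi> x)"
    proof (rule integral_cong_AE)
      show "AE x in unit_leb. u x * deriv \<phi> x = c * deriv \<phi> x + prim v x * deriv \<phi> x"
        using c by eventually_elim (simp add: algebra_simps)
    qed (use i[OF u \<phi>] i[OF p \<phi>] i0 in auto)
    also have "\<dots> = (LINT x|unit_leb. prim v x * deriv \<phi> x)"
      using i[OF p \<phi>] i0 0 by simp
    also have "\<dots> = - (LINT x|unit_leb. v x * \<phi> x)"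
      using has_weak_deriv_prim[OF v] \<phi> unfolding has_weak_deriv_def by simp
    finally show "(LINT x|unit_leb. u x * deriv \<phi> x) = - (LINT x|unit_leb. v x * \<phi> x)" .
  qed
qed

section \<open>The space of functions with clamped boundary values\<close>

lemma L2_integrable:
  assumes "u \<in> L2"
  shows "integrable unit_leb u"
proof (rule Bochner_Integration.integrable_bound)
  show "integrable unit_leb (\<lambda>x. 1 + (u x)\<^sup>2)" using assms by (simp add: L2_def)
  show "u \<in> borel_measurable unit_leb" using assms by (simp add: L2_def)
  have "\<bar>y\<bar> \<le> 1 + y\<^sup>2" for y :: real
    using zero_le_power2[of "\<bar>y\<bar> - 1"] zero_le_power2[of y] by (simp add: power2_diff)
  then show "AE x in unit_leb. norm (u x) \<le> norm (1 + (u x)\<^sup>2)" by simp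
qed

section \<open>A triangle inequality for weighted square integrals\<close>

text \<open>Young's inequality. The parameter stays free because its best value depends on the two
  norms and not on the point.\<close>

lemma sq_add_le:
  fixes x y s :: real
  assumes "s > 0"
  shows "(x + y)\<^sup>2 \<le> (1 + s) * x\<^sup>2 + (1 + 1 / s) * y\<^sup>2"
proof -
  have "(1 + s) * x\<^sup>2 + (1 + 1 / s) * y\<^sup>2 - (x + y)\<^sup>2 = (s * x - y)\<^sup>2 / s"
    using assms by (simp add: field_simps power2_eq_square)
  moreover have "\<dots> \<ge> 0" using assms by simp
  ultimately show ?thesis by linarith
qed

text \<open>
  The triangle inequality is obtained by bounding \<open>Q (u + v)\<close> by \<open>(1 + s) Q u + (1 + 1/s) Q v\<close> for
  all \<open>s > 0\<close>, a form that is preserved under sums of squared seminorms; see \<open>sqrt_triangle\<close>.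
\<close>

lemma weighted_sq_add:
  fixes f g k :: "real \<Rightarrow> real"
  assumes [measurable]: "f \<in> borel_measurable unit_leb" "g \<in> borel_measurable unit_leb"
      "k \<in> borel_measurable unit_leb"
    and k: "\<And>x. x \<in> {0<..<1} \<Longrightarrow> 0 \<le> k x"
    and f: "integrable unit_leb (\<lambda>x. (f x)\<^sup>2 / k x)" and g: "integrable unit_leb (\<lambda>x. (g x)\<^sup>2 / k x)"
  shows "integrable unit_leb (\<lambda>x. (f x + g x)\<^sup>2 / k x)"
    and "s > 0 \<Longrightarrow> (LINT x|unit_leb. (f x + g x)\<^sup>2 / k x)
       \<le> (1 + s) * (LINT x|unit_leb. (f x)\<^sup>2 / k x) + (1 + 1 / s) * (LINT x|unit_leb. (g x)\<^sup>2 / k x)"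
proof -
  have le: "(f x + g x)\<^sup>2 / k x \<le> (1 + s) * ((f x)\<^sup>2 / k x) + (1 + 1 / s) * ((g x)\<^sup>2 / k x)"
    if "s > 0" "x \<in> {0<..<1}" for x s
    using divide_right_mono[OF sq_add_le[OF that(1), of "f x" "g x"] k[OF that(2)]]
    by (simp add: add_divide_distrib)
  show i: "integrable unit_leb (\<lambda>x. (f x + g x)\<^sup>2 / k x)"
  proof (rule Bochner_Integration.integrable_bound)
    \<comment> \<open>The instance \<open>s = 1\<close> of \<open>le\<close>, left unsimplified so
      that the two match.\<close>
    show "integrable unit_leb (\<lambda>x. (1 + 1) * ((f x)\<^sup>2 / k x) + (1 + 1 / 1) * ((g x)\<^sup>2 / k x))"
      using f g by (simp del: times_divide_eq_right)
    show "AE x in unit_leb. norm ((f x + g x)\<^sup>2 / k x)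
        \<le> norm ((1 + 1) * ((f x)\<^sup>2 / k x) + (1 + 1 / 1) * ((g x)\<^sup>2 / k x))"
    proof (rule AE_I2)
      fix x assume "x \<in> space unit_leb"
      then have x: "x \<in> {0<..<1}" by simp
      have "0 \<le> (f x + g x)\<^sup>2 / k x" using k[OF x] by simp
      then show "norm ((f x + g x)\<^sup>2 / k x)
        \<le> norm ((1 + 1) * ((f x)\<^sup>2 / k x) + (1 + 1 / 1) * ((g x)\<^sup>2 / k x))"
        using le[OF _ x, of 1] unfolding real_norm_def by linarith
    qed
  qed measurable
  assume s: "s > 0"
  have "(LINT x|unit_leb. (f x + g x)\<^sup>2 / k x)
      \<le> (LINT x|unit_leb. (1 + s) * ((f x)\<^sup>2 / k x) + (1 + 1 / s) * ((g x)\<^sup>2 / k x))"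
    by (rule integral_mono[OF i]) (use f g le[OF s] in \<open>simp_all del: times_divide_eq_right\<close>)
  also have "\<dots> = (1 + s) * (LINT x|unit_leb. (f x)\<^sup>2 / k x)
      + (1 + 1 / s) * (LINT x|unit_leb. (g x)\<^sup>2 / k x)"
    using f g by (simp del: times_divide_eq_right)
  finally show "(LINT x|unit_leb. (f x + g x)\<^sup>2 / k x)
     \<le> (1 + s) * (LINT x|unit_leb. (f x)\<^sup>2 / k x) + (1 + 1 / s) * (LINT x|unit_leb. (g x)\<^sup>2 / k x)" .
qed

text \<open>The infimum of the bound over \<open>s\<close> is the square of
  \<open>sqrt P + sqrt Q\<close>, reached at the ratio of the roots when both are positive. Adding
  \<open>e / 2\<close> to each root keeps the ratio \<open>q / p\<close> positive and defined when
  \<open>P\<close> or \<open>Q\<close> is 0.\<close>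

lemma sqrt_triangle:
  fixes P Q R :: real
  assumes P: "0 \<le> P" and Q: "0 \<le> Q" and R: "\<And>s. s > 0 \<Longrightarrow> R \<le> (1 + s) * P + (1 + 1 / s) * Q"
  shows "sqrt R \<le> sqrt P + sqrt Q"
proof (rule field_le_epsilon)
  fix e :: real assume "e > 0"
  define p q where "p = sqrt P + e / 2" and "q = sqrt Q + e / 2"
  have pq: "p > 0" "q > 0" using \<open>e > 0\<close> P Q by (auto simp: p_def q_def intro: add_nonneg_pos)
  have "(sqrt P)\<^sup>2 \<le> p\<^sup>2" "(sqrt Q)\<^sup>2 \<le> q\<^sup>2"
    using \<open>e > 0\<close> P Q by (intro power_mono; simp add: p_def q_def)+
  then have "P \<le> p\<^sup>2" "Q \<le> q\<^sup>2" using P Q by simp_all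
  then have "(1 + q / p) * P + (1 + 1 / (q / p)) * Q \<le> (1 + q / p) * p\<^sup>2 + (1 + 1 / (q / p)) * q\<^sup>2"
    using pq by (intro add_mono mult_left_mono) (auto intro: add_nonneg_nonneg)
  also have "\<dots> = (p + q)\<^sup>2" using pq by (simp add: field_simps power2_eq_square)
  finally have "R \<le> (p + q)\<^sup>2" using R[of "q / p"] pq by simp
  then have "sqrt R \<le> p + q" using pq by (simp add: real_le_lsqrt)
  then show "sqrt R \<le> sqrt P + sqrt Q + e" by (simp add: p_def q_def)
qed

lemma L2_add:
  assumes "f \<in> L2" "g \<in> L2"
  shows "(\<lambda>x. f x + g x) \<in> L2"
  using assms weighted_sq_add(1)[of f g "\<lambda>_. 1"] by (auto simp: L2_def)

lemma L2_cmult: "f \<in> L2 \<Longrightarrow> (\<lambda>x. c * f x) \<in> L2"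
  by (auto simp: L2_def power_mult_distrib)

lemma continuous_L2:
  assumes "continuous_on {0..1} f"
  shows "f \<in> L2"
  using continuous_unit_leb(1)[OF assms] continuous_unit_leb(1)[OF continuous_on_power[OF assms, of 2]]
  by (auto simp: L2_def)

lemma L2_cong_AE:
  assumes "f \<in> L2" "g \<in> borel_measurable unit_leb" "AE x in unit_leb. g x = f x"
  shows "g \<in> L2"
proof -
  have "integrable unit_leb (\<lambda>x. (g x)\<^sup>2) \<longleftrightarrow> integrable unit_leb (\<lambda>x. (f x)\<^sup>2)"
    using assms by (intro integrable_cong_AE) (auto simp: L2_def)
  then show ?thesis using assms by (simp add: L2_def)
qed

section \<open>Algebra and estimates of primitives\<close>

lemma prim_0 [simp]: "prim v 0 = 0"
proof -
  have "prim v 0 = (LINT x|unit_leb. 0)"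
    unfolding prim_def by (rule Bochner_Integration.integral_cong) auto
  then show ?thesis by simp
qed

lemma prim_cong_AE:
  assumes v: "integrable unit_leb v" and w: "integrable unit_leb w" and ae: "AE x in unit_leb. v x = w x"
  shows "prim v = prim w"
proof
  fix x
  show "prim v x = prim w x"
    unfolding prim_def
  proof (rule integral_cong_AE)
    show "AE t in unit_leb. indicator {..<x} t * v t = indicator {..<x} t * w t"
      using ae by eventually_elim simp
  qed (intro borel_measurable_integrable integrable_indicator_mult v w; simp)+
qed

lemma prim_add:
  assumes "integrable unit_leb v" "integrable unit_leb w"
  shows "prim (\<lambda>x. v x + w x) = (\<lambda>x. prim v x + prim w x)"
  using integrable_indicator_mult[OF assms(1)] integrable_indicator_mult[OF assms(2)]
  by (auto simp: prim_def distrib_left)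

lemma prim_cmult: "prim (\<lambda>x. c * v x) = (\<lambda>x. c * prim v x)"
  by (auto simp: prim_def mult.left_commute)

lemma integrable_prim: "integrable unit_leb v \<Longrightarrow> integrable unit_leb (prim v)"
  by (rule continuous_unit_leb(1)[OF continuous_prim])

text \<open>Cauchy-Schwarz on an interval of length one, from the integral of the nonnegative square
  of \<open>f - m\<close>; length one is what makes the integral of the constant
  \<open>m\<^sup>2\<close> equal to \<open>m\<^sup>2\<close>.\<close>

lemma prim_sq_le:
  assumes w: "w \<in> L2"
  shows "(prim w x)\<^sup>2 \<le> (LINT t|unit_leb. (w t)\<^sup>2)"
proof -
  define m where "m = prim w x"
  define f where "f t = indicator {..<x} t * w t" for t
  have i: "integrable unit_leb f"
    unfolding f_def using L2_integrable[OF w] by (intro integrable_indicator_mult) auto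
  have w2: "integrable unit_leb (\<lambda>t. (w t)\<^sup>2)" using w by (simp add: L2_def)
  have "m\<^sup>2 = (LINT t|unit_leb. 2 * m * f t - m\<^sup>2)"
    using i by (simp add: m_def f_def[symmetric] prim_def power2_eq_square)
  also have "\<dots> \<le> (LINT t|unit_leb. (w t)\<^sup>2)"
  proof (rule integral_mono)
    fix t
    have "2 * m * f t - m\<^sup>2 \<le> (f t)\<^sup>2"
      using zero_le_power2[of "f t - m"] by (simp add: power2_diff algebra_simps)
    also have "\<dots> \<le> (w t)\<^sup>2" by (simp add: f_def indicator_def)
    finally show "2 * m * f t - m\<^sup>2 \<le> (w t)\<^sup>2" .
  qed (use i w2 in auto)
  finally show ?thesis by (simp add: m_def)
qed

lemma prim_lipschitz:
  assumes v: "integrable unit_leb v" and B: "\<And>t. t \<in> {0<..<1} \<Longrightarrow> \<bar>v t\<bar> \<le> B"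
    and x: "x \<in> {0..1}" and y: "y \<in> {0..1}"
  shows "\<bar>prim v y - prim v x\<bar> \<le> B * \<bar>y - x\<bar>"
proof -
  have le: "\<bar>prim v y - prim v x\<bar> \<le> B * (y - x)" if "0 \<le> x" "x \<le> y" "y \<le> 1" for x y
  proof -
    have i: "integrable unit_leb (\<lambda>t. indicator {x..<y} t * v t)"
      using v by (intro integrable_indicator_mult) auto
    have "prim v y - prim v x = (LINT t|unit_leb. indicator {..<y} t * v t - indicator {..<x} t * v t)"
      unfolding prim_def using v
      by (intro Bochner_Integration.integral_diff[symmetric] integrable_indicator_mult) auto
    also have "(\<lambda>t. indicator {..<y} t * v t - indicator {..<x} t * v t) = (\<lambda>t. indicator {x..<y} t * v t)"
      using that by (auto simp: indicator_def)
    finally have "\<bar>prim v y - prim v x\<bar> \<le> (LINT t|unit_leb. \<bar>indicator {x..<y} t * v t\<bar>)"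
      using integral_abs_bound[of unit_leb] by simp
    also have "\<dots> \<le> (LINT t|unit_leb. indicator {x..<y} t * B)"
    proof (rule integral_mono)
      show "integrable unit_leb (\<lambda>t. indicator {x..<y} t * B)"
        by (intro integrable_indicator_mult) auto
      show "\<bar>indicator {x..<y} t * v t\<bar> \<le> indicator {x..<y} t * B" if "t \<in> space unit_leb" for t
        using B[of t] that by (auto simp: indicator_def)
    qed (use i in auto)
    also have "\<dots> = B * (LINT t|unit_leb. indicator {x..<y} t)" by (simp add: mult.commute)
    also have "(LINT t|unit_leb. indicator {x..<y} t :: real) = y - x"
    proof -
      have "(LINT t|unit_leb. indicator {x..<y} t :: real)
          = (LINT t|lebesgue. indicator {0<..<1} t * indicator {x..<y} t)"
        by (subst integral_restrict_space) auto
      also have "\<dots> = (LINT t|lborel. indicator {0<..<1} t * indicator {x..<y} t)"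
        by (rule integral_completion) auto
      also have "\<dots> = (LINT t|lborel. indicator {x..<y} t)"
      proof (rule integral_cong_AE)
        \<comment> \<open>The half-open interval can leave the open unit interval only at the point
          0.\<close>
        show "AE t in lborel. indicator {0<..<1} t * indicator {x..<y} t = (indicator {x..<y} t :: real)"
          using AE_lborel_singleton[of 0] by eventually_elim (use that in \<open>auto simp: indicator_def\<close>)
      qed auto
      finally show ?thesis using that by simp
    qed
    finally show ?thesis .
  qed
  show ?thesis
    using le[of x y] le[of y x] x y by (cases "x \<le> y") (auto simp: abs_minus_commute)
qed

section \<open>Uniqueness of continuous representatives and weak derivatives\<close>

text \<open>The nonnegative continuous function \<open>\<bar>f x - g x\<bar>\<close> has integral 0
  and so vanishes on the whole closed interval. The end points, where the boundary conditions live,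
  are included.\<close>

lemma continuous_AE_eq:
  fixes f g :: "real \<Rightarrow> real"
  assumes f: "continuous_on {0..1} f" and g: "continuous_on {0..1} g"
    and ae: "AE x in unit_leb. f x = g x" and x: "x \<in> {0..1}"
  shows "f x = g x"
proof -
  have c: "continuous_on {0..1} (\<lambda>x. \<bar>f x - g x\<bar>)" using f g by (intro continuous_intros)
  have "(LINT x|unit_leb. \<bar>f x - g x\<bar>) = 0"
    by (rule integral_eq_zero_AE) (use ae in auto)
  then have "((\<lambda>x. \<bar>f x - g x\<bar>) has_integral 0) (cbox 0 1)"
    using integrable_integral[OF integrable_continuous_real[OF c]] continuous_unit_leb(2)[OF c] by simp
  then have "\<bar>f x - g x\<bar> = 0"
    by (rule has_integral_0_cbox_imp_0[rotated 2]) (use c x in auto)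
  then show ?thesis by simp
qed

lemma cont_rep_eq:
  assumes w: "continuous_on {0..1} w" and ae: "AE x in unit_leb. u x = w x" and x: "x \<in> {0..1}"
  shows "cont_rep u x = w x"
proof -
  have "continuous_on {0..1} (cont_rep u) \<and> (AE x in unit_leb. u x = cont_rep u x)"
    unfolding cont_rep_def by (rule someI[of _ w]) (use w ae in simp)
  then have c: "continuous_on {0..1} (cont_rep u)" and r: "AE x in unit_leb. u x = cont_rep u x"
    by blast+
  have "AE x in unit_leb. cont_rep u x = w x" using r ae by eventually_elim simp
  from continuous_AE_eq[OF c w this x] show ?thesis .
qed

lemma wderiv_H1:
  assumes "u \<in> H1"
  shows "wderiv u \<in> L2" "\<exists>c. AE x in unit_leb. u x = c + prim (wderiv u) x"
proof -
  have "wderiv u \<in> L2 \<and> has_weak_deriv u (wderiv u)"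
    unfolding wderiv_def using assms
    by (intro someI_ex[of "\<lambda>v. v \<in> L2 \<and> has_weak_deriv u v"]) (auto simp: H1_def)
  then show "wderiv u \<in> L2" "\<exists>c. AE x in unit_leb. u x = c + prim (wderiv u) x"
    using has_weak_deriv_iff[of u "wderiv u"] L2_integrable assms by (auto simp: H1_def)
qed

text \<open>The chosen weak derivative gives a second representation of \<open>u\<close> as a
  constant plus a primitive. Both are continuous, hence equal everywhere; at 0 the constants agree,
  so the primitives agree, and with them their integrands a.e.\<close>

lemma H1_wderivI:
  assumes u: "u \<in> borel_measurable unit_leb" and v: "v \<in> L2"
    and ae: "AE x in unit_leb. u x = c + prim v x"
  shows "u \<in> H1" "AE x in unit_leb. wderiv u x = v x"
proof -
  note vi = L2_integrable[OF v]
  have cc: "continuous_on {0..1} (\<lambda>x. c + prim v x)"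
    by (intro continuous_intros continuous_prim vi)
  have L: "u \<in> L2" by (rule L2_cong_AE[OF continuous_L2[OF cc] u ae])
  then show H: "u \<in> H1"
    unfolding H1_def using v ae has_weak_deriv_iff[OF L2_integrable[OF L] vi] by blast
  obtain d where d: "AE x in unit_leb. u x = d + prim (wderiv u) x" using wderiv_H1(2)[OF H] by blast
  have wi: "integrable unit_leb (wderiv u)" using wderiv_H1(1)[OF H] by (rule L2_integrable)
  have "AE x in unit_leb. d + prim (wderiv u) x = c + prim v x"
    using ae d by eventually_elim simp
  then have eq: "d + prim (wderiv u) x = c + prim v x" if "x \<in> {0..1}" for x
    using that by (intro continuous_AE_eq[OF _ cc]) (auto intro!: continuous_intros continuous_prim wi)
  have "d = c" using eq[of 0] by simp
  \<comment> \<open>The difference is spelled as a sum with factor -1 so that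
    \<open>prim_add\<close> and \<open>prim_cmult\<close> apply.\<close>
  have "AE x in unit_leb. wderiv u x + (-1) * v x = 0"
  proof (rule AE_zero_if_prim_zero)
    show "integrable unit_leb (\<lambda>x. wderiv u x + (-1) * v x)" using wi vi by simp
    have "prim (\<lambda>x. wderiv u x + (-1) * v x) = (\<lambda>x. prim (wderiv u) x + (-1) * prim v x)"
      using wi vi by (subst prim_add) (simp_all only: prim_cmult, simp)
    then show "prim (\<lambda>x. wderiv u x + (-1) * v x) x = 0" if "x \<in> {0..1}" for x
      using eq[OF that] \<open>d = c\<close> by simp
  qed
  then show "AE x in unit_leb. wderiv u x = v x" by eventually_elim simp
qed

text \<open>
  The two conditions at \<open>1\<close> are the boundary conditions there; those at \<open>0\<close> are built into \<^const>\<open>prim\<close>.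
\<close>

definition H20_with_dd :: "(real \<Rightarrow> real) \<Rightarrow> (real \<Rightarrow> real) \<Rightarrow> bool" where
  "H20_with_dd u w \<longleftrightarrow> u \<in> borel_measurable unit_leb \<and> w \<in> L2 \<and>
     (AE x in unit_leb. u x = prim (prim w) x) \<and> prim w 1 = 0 \<and> prim (prim w) 1 = 0"

text \<open>Evaluates all the choices hidden in \<open>wderiv\<close> and \<open>cont_rep\<close>:
  \<open>H1_wderivI\<close> is applied to \<open>u\<close> with \<open>prim w\<close>, and then to
  \<open>wderiv u\<close> with \<open>w\<close>, both times with constant 0.\<close>

lemma H20_with_ddD:
  assumes "H20_with_dd u w"
  shows "u \<in> H20" "AE x in unit_leb. wderiv u x = prim w x"
    "AE x in unit_leb. wderiv (wderiv u) x = w x"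
    "x \<in> {0..1} \<Longrightarrow> cont_rep u x = prim (prim w) x"
proof -
  have u: "u \<in> borel_measurable unit_leb" and w: "w \<in> L2" and 1: "prim w 1 = 0" "prim (prim w) 1 = 0"
    and ae: "AE x in unit_leb. u x = prim (prim w) x"
    using assms by (auto simp: H20_with_dd_def)
  note wi = L2_integrable[OF w]
  note c = continuous_prim[OF wi] continuous_prim[OF integrable_prim[OF wi]]
  have ae0: "AE x in unit_leb. u x = 0 + prim (prim w) x" using ae by simp
  note v = H1_wderivI[OF u continuous_L2[OF c(1)] ae0]
  then have ae1: "AE x in unit_leb. wderiv u x = 0 + prim w x" by simp
  have m: "wderiv u \<in> borel_measurable unit_leb" using wderiv_H1(1)[OF v(1)] by (simp add: L2_def)
  note v' = H1_wderivI[OF m w ae1]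
  show "AE x in unit_leb. wderiv u x = prim w x" "AE x in unit_leb. wderiv (wderiv u) x = w x"
    using v v' by auto
  show r: "x \<in> {0..1} \<Longrightarrow> cont_rep u x = prim (prim w) x" for x
    using cont_rep_eq[OF c(2) ae] .
  have r': "x \<in> {0..1} \<Longrightarrow> cont_rep (wderiv u) x = prim w x" for x
    using cont_rep_eq[OF c(1) v(2)] .
  show "u \<in> H20"
    using v(1) v'(1) r r' 1 by (auto simp: H20_def H2_def)
qed

text \<open>Primitives vanish at 0, so the boundary conditions at 0 remove both constants of
  integration, and those at 1 become the two remaining equations.\<close>

lemma H20_imp_with_dd:
  assumes "u \<in> H20"
  shows "H20_with_dd u (wderiv (wderiv u))"
proof -
  define v w where "v = wderiv u" and "w = wderiv v"
  have u: "u \<in> H1" and v: "v \<in> H1" and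
    bc: "cont_rep u 0 = 0" "cont_rep u 1 = 0" "cont_rep v 0 = 0" "cont_rep v 1 = 0"
    using assms by (auto simp: H20_def H2_def v_def)
  have w: "w \<in> L2" "v \<in> L2" using wderiv_H1(1) u v by (auto simp: v_def w_def)
  note wi = L2_integrable[OF w(1)] L2_integrable[OF w(2)]
  obtain c where c: "AE x in unit_leb. v x = c + prim w x" using wderiv_H1(2)[OF v] w_def by auto
  have rv: "cont_rep v x = c + prim w x" if "x \<in> {0..1}" for x
    by (rule cont_rep_eq[OF _ c that]) (intro continuous_intros continuous_prim wi)
  have "c = 0" "prim w 1 = 0" using rv[of 0] rv[of 1] bc by auto
  then have "AE x in unit_leb. v x = prim w x" using c by simp
  then have pv: "prim v = prim (prim w)" using wi by (intro prim_cong_AE integrable_prim)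
  obtain d where d: "AE x in unit_leb. u x = d + prim (prim w) x" using wderiv_H1(2)[OF u] v_def pv by auto
  have ru: "cont_rep u x = d + prim (prim w) x" if "x \<in> {0..1}" for x
    by (rule cont_rep_eq[OF _ d that]) (intro continuous_intros continuous_prim integrable_prim wi)
  have "d = 0" "prim (prim w) 1 = 0" using ru[of 0] ru[of 1] bc by auto
  then show ?thesis
    using d w \<open>prim w 1 = 0\<close> u by (auto simp: H20_with_dd_def H1_def L2_def w_def v_def)
qed

section \<open>Linear structure and the second-derivative norm\<close>

lemma H20_with_dd_zero:
  assumes "u \<in> borel_measurable unit_leb" "AE x in unit_leb. u x = 0"
  shows "H20_with_dd u (\<lambda>_. 0)"
  using assms by (simp add: H20_with_dd_def L2_def prim_def)

lemma H20_with_dd_add: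
  assumes "H20_with_dd u v" "H20_with_dd u' v'"
  shows "H20_with_dd (\<lambda>x. u x + u' x) (\<lambda>x. v x + v' x)"
proof -
  have i: "integrable unit_leb v" "integrable unit_leb v'"
    using assms L2_integrable by (auto simp: H20_with_dd_def)
  have p: "prim (\<lambda>x. v x + v' x) = (\<lambda>x. prim v x + prim v' x)"
    "prim (\<lambda>x. prim v x + prim v' x) = (\<lambda>x. prim (prim v) x + prim (prim v') x)"
    by (intro prim_add integrable_prim i)+
  show ?thesis
    using assms unfolding H20_with_dd_def p by (auto intro: L2_add)
qed

lemma H20_with_dd_cmult:
  assumes "H20_with_dd u v"
  shows "H20_with_dd (\<lambda>x. c * u x) (\<lambda>x. c * v x)"
  using assms unfolding H20_with_dd_def prim_cmult by (auto intro: L2_cmult)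

text \<open>For sums and multiples \<open>wderiv\<close> is chosen afresh; this permits the evident
  second derivative in its place.\<close>

lemma sqnorm_dd_eq:
  assumes "H20_with_dd u w"
  shows "sqnorm_dd u = (LINT x|unit_leb. (w x)\<^sup>2)"
  unfolding sqnorm_dd_def
proof (rule integral_cong_AE)
  have "H20_with_dd u (wderiv (wderiv u))"
    using H20_imp_with_dd H20_with_ddD(1)[OF assms] by blast
  then show "(\<lambda>x. (wderiv (wderiv u) x)\<^sup>2) \<in> borel_measurable unit_leb"
    by (auto simp: H20_with_dd_def L2_def)
  show "(\<lambda>x. (w x)\<^sup>2) \<in> borel_measurable unit_leb" using assms by (auto simp: H20_with_dd_def L2_def)
  show "AE x in unit_leb. (wderiv (wderiv u) x)\<^sup>2 = (w x)\<^sup>2"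
    using H20_with_ddD(3)[OF assms] by eventually_elim simp
qed

lemma sqnorm_dd_nonneg: "0 \<le> sqnorm_dd u"
  by (simp add: sqnorm_dd_def)

lemma sqnorm_dd_add:
  assumes "u \<in> H20" "v \<in> H20" "s > 0"
  shows "sqnorm_dd (\<lambda>x. u x + v x) \<le> (1 + s) * sqnorm_dd u + (1 + 1 / s) * sqnorm_dd v"
proof -
  note d = H20_imp_with_dd[OF assms(1)] H20_imp_with_dd[OF assms(2)]
  then show ?thesis
    using sqnorm_dd_eq[OF H20_with_dd_add[OF d]] assms(3)
      weighted_sq_add(2)[of "wderiv (wderiv u)" "wderiv (wderiv v)" "\<lambda>_. 1" s]
    by (auto simp: H20_with_dd_def L2_def sqnorm_dd_def)
qed

lemma sqnorm_dd_cmult: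
  assumes "u \<in> H20"
  shows "sqnorm_dd (\<lambda>x. c * u x) = c\<^sup>2 * sqnorm_dd u"
  using sqnorm_dd_eq[OF H20_with_dd_cmult[OF H20_imp_with_dd[OF assms]]]
  by (simp add: sqnorm_dd_def power_mult_distrib)

text \<open>If the norm vanishes, \<open>prim_sq_le\<close> makes \<open>prim w\<close> vanish
  identically, and \<open>u\<close> is a.e. its primitive. Conversely, 0 is an admissible second
  derivative of an a.e. vanishing \<open>u\<close>.\<close>

lemma sqnorm_dd_eq_0_iff:
  assumes "u \<in> H20"
  shows "sqnorm_dd u = 0 \<longleftrightarrow> (AE x in unit_leb. u x = 0)"
proof
  note d = H20_imp_with_dd[OF assms]
  define w where "w = wderiv (wderiv u)"
  have w: "w \<in> L2" and u: "u \<in> borel_measurable unit_leb" "AE x in unit_leb. u x = prim (prim w) x"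
    using d by (auto simp: H20_with_dd_def w_def)
  {
    assume "sqnorm_dd u = 0"
    then have "prim w = (\<lambda>_. 0)" using prim_sq_le[OF w] by (auto simp: sqnorm_dd_def w_def)
    then show "AE x in unit_leb. u x = 0" using u(2) by (simp add: prim_def)
  }
  assume "AE x in unit_leb. u x = 0"
  from sqnorm_dd_eq[OF H20_with_dd_zero[OF u(1) this]] show "sqnorm_dd u = 0" by simp
qed

lemma H20_lipschitz:
  assumes "u \<in> H20" "x \<in> {0..1}" "y \<in> {0..1}"
  shows "\<bar>cont_rep u y - cont_rep u x\<bar> \<le> sqrt (sqnorm_dd u) * \<bar>y - x\<bar>"
proof -
  define w where "w = wderiv (wderiv u)"
  have d: "H20_with_dd u w" using H20_imp_with_dd[OF assms(1)] by (simp add: w_def)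
  then have w: "w \<in> L2" by (simp add: H20_with_dd_def)
  have "\<bar>prim (prim w) y - prim (prim w) x\<bar> \<le> sqrt (sqnorm_dd u) * \<bar>y - x\<bar>"
  proof (rule prim_lipschitz)
    show "integrable unit_leb (prim w)" using w by (intro integrable_prim L2_integrable)
    show "\<bar>prim w t\<bar> \<le> sqrt (sqnorm_dd u)" for t
      using real_sqrt_le_mono[OF prim_sq_le[OF w, of t]] by (simp add: sqnorm_dd_def w_def)
  qed (use assms in auto)
  then show ?thesis using H20_with_ddD(4)[OF d] assms by simp
qed

lemma H20_cont_rep:
  assumes "u \<in> H20"
  shows "continuous_on {0..1} (cont_rep u)" "AE x in unit_leb. u x = cont_rep u x"
proof -
  define w where "w = wderiv (wderiv u)"
  have d: "H20_with_dd u w" using H20_imp_with_dd[OF assms(1)] by (simp add: w_def)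
  then have w: "w \<in> L2" and ae: "AE x in unit_leb. u x = prim (prim w) x"
    by (auto simp: H20_with_dd_def)
  have "continuous_on {0..1} (prim (prim w))"
    using w by (intro continuous_prim integrable_prim L2_integrable)
  then show "continuous_on {0..1} (cont_rep u)"
    by (rule continuous_on_eq) (simp add: H20_with_ddD(4)[OF d])
  show "AE x in unit_leb. u x = cont_rep u x"
    using ae AE_space by eventually_elim (simp add: H20_with_ddD(4)[OF d])
qed

lemma integrable_inverse_if_weighted:
  fixes a U :: "real \<Rightarrow> real"
  assumes a: "continuous_on {0..1} a" "\<And>x. x \<in> {0..1} \<Longrightarrow> 0 \<le> a x"
    and U: "continuous_on {0..1} U" "integrable unit_leb (\<lambda>x. (U x)\<^sup>2 / a x)"
    and pos: "\<And>x. x \<in> {0..1} \<Longrightarrow> U x \<noteq> 0 \<or> 0 < a x"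
  shows "integrable unit_leb (\<lambda>x. 1 / a x)"
proof -
  text \<open>If \<open>m > 0\<close> is the minimum of \<open>U\<^sup>2 + a\<close>, then \<open>1 / a \<le> (U\<^sup>2 / a + 1) / m\<close>.\<close>
  have "continuous_on {0..1} (\<lambda>x. (U x)\<^sup>2 + a x)" using a U by (intro continuous_intros)
  then obtain z where z: "z \<in> {0..1}" "\<forall>x\<in>{0..1}. (U z)\<^sup>2 + a z \<le> (U x)\<^sup>2 + a x"
    using continuous_attains_inf[of "{0..1}" "\<lambda>x. (U x)\<^sup>2 + a x"] by auto
  define m where "m = (U z)\<^sup>2 + a z"
  have m: "m > 0" using pos[OF z(1)] a(2)[OF z(1)] unfolding m_def
    by (auto intro: add_pos_nonneg add_nonneg_pos)
  have [measurable]: "a \<in> borel_measurable unit_leb" using continuous_unit_leb(1)[OF a(1)] by auto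
  show ?thesis
  proof (rule Bochner_Integration.integrable_bound)
    show "integrable unit_leb (\<lambda>x. ((U x)\<^sup>2 / a x + 1) / m)" using U(2) by simp
    show "AE x in unit_leb. norm (1 / a x) \<le> norm (((U x)\<^sup>2 / a x + 1) / m)"
    proof (rule AE_I2)
      fix x assume "x \<in> space unit_leb"
      then have x: "x \<in> {0..1}" by simp
      show "norm (1 / a x) \<le> norm (((U x)\<^sup>2 / a x + 1) / m)"
      \<comment> \<open>At a zero of \<open>a\<close> the left side is \<open>1 / 0 = 0\<close>, so
        the estimate is trivial there.\<close>
      proof (cases "a x = 0")
        case False
        then have ax: "a x > 0" using a(2)[OF x] by simp
        have "m \<le> (U x)\<^sup>2 + a x" using z(2) x by (simp add: m_def)
        then have "m / (m * a x) \<le> ((U x)\<^sup>2 + a x) / (m * a x)"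
          using m ax by (intro divide_right_mono) auto
        then have "1 / a x \<le> ((U x)\<^sup>2 / a x + 1) / m" using m ax by (simp add: field_simps)
        then show ?thesis using m ax by simp
      qed simp
    qed
  qed measurable
qed

section \<open>The weighted space\<close>

lemma H2_inv_cont_rep_zero:
  fixes a :: "real \<Rightarrow> real"
  assumes a: "continuous_on {0..1} a" "\<forall>x\<in>{0..1} - {x0}. 0 < a x"
    and x0: "x0 \<in> {0..1}" "a x0 = 0"
    and na: "\<not> integrable unit_leb (\<lambda>x. 1 / a x)"
    and u: "u \<in> H2_inv a"
  shows "cont_rep u x0 = 0"
proof (rule ccontr)
  assume n: "cont_rep u x0 \<noteq> 0"
  have H: "u \<in> H20" using u by (simp add: H2_inv_def)
  note c = H20_cont_rep[OF H]
  have nn: "0 \<le> a x" if "x \<in> {0..1}" for x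
    using a(2) x0 that by (cases "x = x0") (auto intro: less_imp_le)
  have [measurable]: "a \<in> borel_measurable unit_leb" "cont_rep u \<in> borel_measurable unit_leb"
    using continuous_unit_leb(1)[OF a(1)] continuous_unit_leb(1)[OF c(1)] by auto
  have ui: "integrable unit_leb (\<lambda>x. (u x)\<^sup>2 / a x)" using u by (simp add: H2_inv_def L2_inv_def)
  have "AE x in unit_leb. (u x)\<^sup>2 / a x = (cont_rep u x)\<^sup>2 / a x"
    using c(2) by eventually_elim simp
  then have "integrable unit_leb (\<lambda>x. (cont_rep u x)\<^sup>2 / a x)"
    using ui by (subst integrable_cong_AE[symmetric]) auto
  \<comment> \<open>At \<open>x0\<close> the first alternative is the assumption to be refuted;
    elsewhere \<open>a\<close> is positive.\<close>
  moreover have "cont_rep u x \<noteq> 0 \<or> 0 < a x" if "x \<in> {0..1}" for x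
    using that n a(2) by auto
  ultimately have "integrable unit_leb (\<lambda>x. 1 / a x)"
    using a(1) c(1) nn by (intro integrable_inverse_if_weighted)
  then show False using na by simp
qed

lemma weighted_norm_le:
  fixes a :: "real \<Rightarrow> real"
  assumes a: "continuous_on {0..1} a" "a x0 = 0"
    and x0: "x0 \<in> {0..1}"
    and K: "K \<le> 2" and C: "C > 0"
    and bound: "\<forall>x\<in>{0..1} - {x0}. 1 / a x \<le> C / \<bar>x - x0\<bar> powr K"
    and u: "u \<in> H2_inv a" "cont_rep u x0 = 0"
  shows "(LINT x|unit_leb. (u x)\<^sup>2 / a x) \<le> C * sqnorm_dd u"
proof -
  have H: "u \<in> H20" using u by (simp add: H2_inv_def)
  note c = H20_cont_rep[OF H]
  have "(LINT x|unit_leb. (u x)\<^sup>2 / a x) \<le> (LINT x|unit_leb. C * sqnorm_dd u)"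
  proof (rule integral_mono_AE)
    show "integrable unit_leb (\<lambda>x. (u x)\<^sup>2 / a x)" using u by (simp add: H2_inv_def L2_inv_def)
    show "AE x in unit_leb. (u x)\<^sup>2 / a x \<le> C * sqnorm_dd u"
      using c(2) AE_space
    proof eventually_elim
      fix x assume ux: "u x = cont_rep u x" and "x \<in> space unit_leb"
      then have x: "x \<in> {0..1}" by simp
      show "(u x)\<^sup>2 / a x \<le> C * sqnorm_dd u"
      proof (cases "x = x0")
        case True
        then show ?thesis using a(2) C sqnorm_dd_nonneg[of u] by simp
      next
        case False
        define r where "r = \<bar>x - x0\<bar>"
        \<comment> \<open>Both points lie in the unit interval; \<open>r\<close> at most 1 is what
          lets the exponent 2 be lowered to \<open>K\<close>.\<close>
        have r: "0 < r" "r \<le> 1" using False x x0 by (auto simp: r_def)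
        have "\<bar>u x\<bar> \<le> sqrt (sqnorm_dd u) * r"
          using H20_lipschitz[OF H x0 x] u(2) ux by (simp add: r_def)
        then have "\<bar>u x\<bar>\<^sup>2 \<le> (sqrt (sqnorm_dd u) * r)\<^sup>2" by (rule power_mono) simp
        then have u2: "(u x)\<^sup>2 \<le> sqnorm_dd u * r\<^sup>2"
          using sqnorm_dd_nonneg[of u] by (simp add: power_mult_distrib)
        have "r\<^sup>2 = r powr 2" using r by simp
        also have "\<dots> \<le> r powr K" using r K by (intro powr_mono') auto
        finally have rK: "r\<^sup>2 \<le> r powr K" .
        have "(u x)\<^sup>2 / a x \<le> (u x)\<^sup>2 * (C / r powr K)"
          using mult_left_mono[of "1 / a x" "C / r powr K" "(u x)\<^sup>2"] bound x False
          by (simp add: r_def)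
        also have "\<dots> \<le> (sqnorm_dd u * r powr K) * (C / r powr K)"
          using order_trans[OF u2 mult_left_mono[OF rK sqnorm_dd_nonneg]] C r
          by (intro mult_right_mono) auto
        also have "\<dots> = C * sqnorm_dd u" using r by simp
        finally show ?thesis .
      qed
    qed
  qed simp
  then show ?thesis by simp
qed

lemma H2_inv_add:
  assumes a: "a \<in> borel_measurable unit_leb" "\<And>x. x \<in> {0<..<1} \<Longrightarrow> 0 \<le> a x"
    and u: "u \<in> H2_inv a" and v: "v \<in> H2_inv a"
  shows "(\<lambda>x. u x + v x) \<in> H2_inv a"
proof -
  have "(\<lambda>x. u x + v x) \<in> H20"
    using H20_with_ddD(1)[OF H20_with_dd_add[OF H20_imp_with_dd H20_imp_with_dd]] u v
    by (simp add: H2_inv_def)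
  moreover have "integrable unit_leb (\<lambda>x. (u x + v x)\<^sup>2 / a x)"
    using a u v by (intro weighted_sq_add(1)) (auto simp: H2_inv_def L2_inv_def L2_def)
  ultimately show ?thesis
    using u v by (auto simp: H2_inv_def L2_inv_def L2_add)
qed

lemma H2_inv_cmult:
  assumes u: "u \<in> H2_inv a"
  shows "(\<lambda>x. c * u x) \<in> H2_inv a"
proof -
  have "(\<lambda>x. c * u x) \<in> H20"
    using H20_with_ddD(1)[OF H20_with_dd_cmult[OF H20_imp_with_dd]] u by (simp add: H2_inv_def)
  moreover have "integrable unit_leb (\<lambda>x. c\<^sup>2 * ((u x)\<^sup>2 / a x))"
    using u by (simp add: H2_inv_def L2_inv_def del: times_divide_eq_right)
  ultimately show ?thesis
    using u by (auto simp: H2_inv_def L2_inv_def L2_cmult power_mult_distrib)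
qed

lemma sqnorm_dd_le_sqnorm2:
  assumes "\<And>x. x \<in> {0<..<1} \<Longrightarrow> 0 \<le> a x"
  shows "sqnorm_dd u \<le> sqnorm2 a u"
  using assms by (auto simp: sqnorm2_def intro!: integral_nonneg_AE)

text \<open>Shared by both norms. All conditions concern the square \<open>Q\<close>, where they are
  additive in its summands; \<open>sqrt_triangle\<close> alone turns them into a statement about the
  root.\<close>

lemma ae_norm_onI:
  assumes zero: "(\<lambda>x. 0) \<in> V"
    and add: "\<And>u v. u \<in> V \<Longrightarrow> v \<in> V \<Longrightarrow> (\<lambda>x. u x + v x) \<in> V"
    and cmult: "\<And>u c. u \<in> V \<Longrightarrow> (\<lambda>x. c * u x) \<in> V"
    and nonneg: "\<And>u. u \<in> V \<Longrightarrow> 0 \<le> Q u"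
    and Q_add: "\<And>u v s. u \<in> V \<Longrightarrow> v \<in> V \<Longrightarrow> s > 0 \<Longrightarrow>
      Q (\<lambda>x. u x + v x) \<le> (1 + s) * Q u + (1 + 1 / s) * Q v"
    and Q_cmult: "\<And>u c. u \<in> V \<Longrightarrow> Q (\<lambda>x. c * u x) = c\<^sup>2 * Q u"
    and Q_zero: "\<And>u. u \<in> V \<Longrightarrow> Q u = 0 \<longleftrightarrow> (AE x in unit_leb. u x = 0)"
  shows "ae_norm_on V (\<lambda>u. sqrt (Q u))"
  unfolding ae_norm_on_def
  using assms by (auto simp: real_sqrt_mult intro!: sqrt_triangle)

theorem proposition3p2:
  fixes a :: "real \<Rightarrow> real" and x0 :: real
  assumes "continuous_on {0..1} a"
    and "\<forall>x\<in>{0..1}. 0 \<le> a x"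
    and "x0 \<in> {0<..<1}"
    and "a x0 = 0"
    and "\<forall>x\<in>{0..1} - {x0}. 0 < a x"
    and "\<not> integrable unit_leb (\<lambda>x. 1 / a x)"
    and "\<exists>K\<in>{1..2}. \<exists>C>0. \<forall>x\<in>{0..1} - {x0}. 1 / a x \<le> C / \<bar>x - x0\<bar> powr K"
  shows "X_space a x0 = H2_inv a \<and>
         equivalent_norms_on (H2_inv a) (\<lambda>u. sqrt (sqnorm2 a u)) (\<lambda>u. sqrt (sqnorm_dd u))"
proof
  let ?V = "H2_inv a"
  have x0: "x0 \<in> {0..1}" using assms(3) by auto
  have a0: "0 \<le> a x" if "x \<in> {0<..<1}" for x using assms(2) that by auto
  have am: "a \<in> borel_measurable unit_leb" using continuous_unit_leb(1)[OF assms(1)] by auto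
  have H: "u \<in> H20" if "u \<in> ?V" for u using that by (simp add: H2_inv_def)
  have z: "cont_rep u x0 = 0" if "u \<in> ?V" for u
    using H2_inv_cont_rep_zero[OF assms(1,5) x0 assms(4,6) that] .
  \<comment> \<open>The choice is made for the product as a whole, so a continuous representative of
    the product is exhibited: \<open>a\<close> times \<open>prim w\<close>, which is 0 at
    \<open>x0\<close> because \<open>a\<close> is.\<close>
  have z': "cont_rep (\<lambda>x. a x * wderiv u x) x0 = 0" if "u \<in> ?V" for u
  proof -
    define w where "w = wderiv (wderiv u)"
    have d: "H20_with_dd u w" using H20_imp_with_dd[OF H[OF that]] by (simp add: w_def)
    then have "integrable unit_leb w" using L2_integrable by (simp add: H20_with_dd_def)
    then have "continuous_on {0..1} (\<lambda>x. a x * prim w x)"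
      by (intro continuous_on_mult assms(1) continuous_prim)
    moreover have "AE x in unit_leb. a x * wderiv u x = a x * prim w x"
      using H20_with_ddD(2)[OF d] by eventually_elim simp
    ultimately show ?thesis using cont_rep_eq[OF _ _ x0] assms(4) by fastforce
  qed
  show "X_space a x0 = ?V" using z z' by (auto simp: X_space_def)

  obtain K C where K: "K \<le> 2" and C: "C > 0"
    and bound: "\<forall>x\<in>{0..1} - {x0}. 1 / a x \<le> C / \<bar>x - x0\<bar> powr K"
    using assms(7) by auto
  have le: "sqnorm2 a u \<le> (1 + C) * sqnorm_dd u" if "u \<in> ?V" for u
    using weighted_norm_le[OF assms(1,4) x0 K C bound that z[OF that]]
    by (simp add: sqnorm2_def algebra_simps)
  have ge: "sqnorm_dd u \<le> sqnorm2 a u" for u by (rule sqnorm_dd_le_sqnorm2[OF a0])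
  have V0: "(\<lambda>x. 0) \<in> ?V"
    using H20_with_ddD(1)[OF H20_with_dd_zero[of "\<lambda>_. 0"]] by (simp add: H2_inv_def L2_inv_def L2_def)
  \<comment> \<open>Squeezed between \<open>sqnorm_dd u\<close> and \<open>1 + C\<close> times it,
    \<open>sqnorm2 a u\<close> vanishes exactly when \<open>sqnorm_dd u\<close> does.\<close>
  have Q_zero: "sqnorm2 a u = 0 \<longleftrightarrow> (AE x in unit_leb. u x = 0)" if "u \<in> ?V" for u
    using le[OF that] ge[of u] sqnorm_dd_nonneg[of u] sqnorm_dd_eq_0_iff[OF H[OF that]] by auto
  have Q_add: "sqnorm2 a (\<lambda>x. u x + v x) \<le> (1 + s) * sqnorm2 a u + (1 + 1 / s) * sqnorm2 a v"
    if "u \<in> ?V" "v \<in> ?V" "s > 0" for u v s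
  proof -
    have "(LINT x|unit_leb. (u x + v x)\<^sup>2 / a x)
       \<le> (1 + s) * (LINT x|unit_leb. (u x)\<^sup>2 / a x) + (1 + 1 / s) * (LINT x|unit_leb. (v x)\<^sup>2 / a x)"
      using that am a0 by (intro weighted_sq_add(2)) (auto simp: H2_inv_def L2_inv_def L2_def)
    then show ?thesis
      using sqnorm_dd_add[OF H[OF that(1)] H[OF that(2)] that(3)]
      by (simp add: sqnorm2_def distrib_left)
  qed
  have Q_cmult: "sqnorm2 a (\<lambda>x. c * u x) = c\<^sup>2 * sqnorm2 a u" if "u \<in> ?V" for c u
  proof -
    have "(\<lambda>x. (c * u x)\<^sup>2 / a x) = (\<lambda>x. c\<^sup>2 * ((u x)\<^sup>2 / a x))"
      by (simp add: power_mult_distrib)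
    then show ?thesis
      using sqnorm_dd_cmult[OF H[OF that], of c]
      by (simp add: sqnorm2_def distrib_left del: times_divide_eq_right)
  qed
  have "ae_norm_on ?V (\<lambda>u. sqrt (sqnorm2 a u))"
    using V0 H2_inv_add[OF am a0] H2_inv_cmult order_trans[OF sqnorm_dd_nonneg ge] Q_add Q_cmult Q_zero
    by (intro ae_norm_onI) auto
  moreover have "ae_norm_on ?V (\<lambda>u. sqrt (sqnorm_dd u))"
    using V0 H2_inv_add[OF am a0] H2_inv_cmult sqnorm_dd_nonneg sqnorm_dd_add[OF H H]
      sqnorm_dd_cmult[OF H] sqnorm_dd_eq_0_iff[OF H]
    by (intro ae_norm_onI) auto
  moreover have "1 * sqrt (sqnorm_dd u) \<le> sqrt (sqnorm2 a u) \<and>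
      sqrt (sqnorm2 a u) \<le> sqrt (1 + C) * sqrt (sqnorm_dd u)" if "u \<in> ?V" for u
    using le[OF that] ge[of u] by (simp add: real_sqrt_mult[symmetric])
  moreover have "sqrt (1 + C) > 0" using C by simp
  ultimately show "equivalent_norms_on ?V (\<lambda>u. sqrt (sqnorm2 a u)) (\<lambda>u. sqrt (sqnorm_dd u))"
    unfolding equivalent_norms_on_def using zero_less_one by blast
qed

end
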